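(* No semi-walled wedge can be explored by a finite deterministic automaton without any pebble (i.e., with $p=0$).
   Context: The oriented grid $\mathbb{Z}\times\mathbb{Z}$ is embedded in the plane (nodes at integer points, edges between nodes at distance 1); nodes are anonymous and every node has ports $N,E,S,W$ pointing North, East, South, West. Given two half-lines $H_1,H_2$ in the plane with a common origin $O$ (an arbitrary point; arbitrary real directions), let $W(H_1,H_2)$ be the closed region swept clockwise from $H_1$ to $H_2$ (half-lines included); the wedge is the subgraph of the grid induced by the grid nodes in $W(H_1,H_2)$ (the clockwise angle may be any value in $(0,2\pi]$). Consider grid edges $\{u,v\}$ with $u$ in the wedge, $v$ not in the wedge and $H_i$ meeting the closed segment $[u,v]$: $H_i$ is a wall if the ports of all such edges at $u$ and $v$ are blocked (cannot be taken), and free if they are free. A wedge is semi-walled if $H_1$ is a wall and $H_2$ is free; all other ports are free. The agent is a finite deterministic (Mealy) automaton carrying $p$ pebbles: at each step it sees which ports at the current node are free, whether a pebble lies there, and how many pebbles it carries; depending on its state and this input it moves through a free port, possibly dropping or picking up a pebble, and changes state. It starts in its initial state at an adversarially chosen node of the wedge. An automaton explores the wedge if for every starting node in the wedge every node of the wedge is eventually visited. *)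

theory Defs
  imports "HOL-Analysis.Analysis"
begin

type_synonym node = "int \<times> int"

datatype port = North | East | South | West

fun neighbour :: "node \<Rightarrow> port \<Rightarrow> node" where
  "neighbour (x, y) North = (x, y + 1)"
| "neighbour (x, y) East = (x + 1, y)"
| "neighbour (x, y) South = (x, y - 1)"
| "neighbour (x, y) West = (x - 1, y)"

definition point :: "node \<Rightarrow> complex" where
  "point u = Complex (of_int (fst u)) (of_int (snd u))"

definition half_line :: "complex \<Rightarrow> real \<Rightarrow> complex set" where
  "half_line p \<theta> = {p + of_real r * cis \<theta> | r. r \<ge> 0}"

text \<open>
  Turning clockwise decreases the angle. A pair of half-lines with origin \<open>p\<close> is given by
  angles \<open>\<theta>1\<close>, \<open>\<theta>2\<close> of representatives chosen with \<open>\<theta>1 - 2 * pi \<le> \<theta>2 < \<theta>1\<close>, so that the clockwise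
  angle from the first to the second is \<open>\<theta>1 - \<theta>2\<close>, in the interval from 0 (excluded) to \<open>2 * pi\<close>
  (included, for equal half-lines).
\<close>

definition clockwise_region :: "complex \<Rightarrow> real \<Rightarrow> real \<Rightarrow> complex set" where
  "clockwise_region p \<theta>1 \<theta>2 = (\<Union>\<theta>\<in>{\<theta>2..\<theta>1}. half_line p \<theta>)"

definition wedge :: "complex \<Rightarrow> real \<Rightarrow> real \<Rightarrow> node set" where
  "wedge p \<theta>1 \<theta>2 = {u. point u \<in> clockwise_region p \<theta>1 \<theta>2}"

definition crossing_edges :: "node set \<Rightarrow> complex set \<Rightarrow> node set set" where
  "crossing_edges V H =
     {{u, v} | u v. u \<in> V \<and> v \<notin> V \<and> (\<exists>d. v = neighbour u d) \<and>
                    H \<inter> closed_segment (point u) (point v) \<noteq> {}}"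

text \<open>
  \<open>B\<close> is the set of blocked edges: an edge is in \<open>B\<close> iff its ports at both endpoints are blocked.
  Near the origin an edge may be met by both half-lines, for example if the origin is a node; being
  a wall and being free then make contradictory demands on it. Such an edge may be blocked or free
  here, and every way of resolving these conflicts is a semi-walled wedge.
\<close>

definition is_wall :: "node set set \<Rightarrow> node set set \<Rightarrow> bool" where
  "is_wall B E \<longleftrightarrow> E \<subseteq> B"

definition is_free :: "node set set \<Rightarrow> node set set \<Rightarrow> bool" where
  "is_free B E \<longleftrightarrow> E \<inter> B = {}"

definition semi_walled :: "complex \<Rightarrow> real \<Rightarrow> real \<Rightarrow> node set set \<Rightarrow> bool" where
  "semi_walled p \<theta>1 \<theta>2 B \<longleftrightarrow>
     (let E1 = crossing_edges (wedge p \<theta>1 \<theta>2) (half_line p \<theta>1);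
          E2 = crossing_edges (wedge p \<theta>1 \<theta>2) (half_line p \<theta>2)
      in is_wall B (E1 - E2) \<and> is_free B (E2 - E1) \<and> is_free B (- (E1 \<union> E2)))"

definition free_ports :: "node set set \<Rightarrow> node \<Rightarrow> port set" where
  "free_ports B u = {d. {u, neighbour u d} \<notin> B}"

datatype pebble_action = Keep | Drop | PickUp

text \<open>Free ports at the node, presence of a pebble there, number of pebbles carried.\<close>

type_synonym observation = "port set \<times> bool \<times> nat"

record 's automaton =
  init :: 's
  next_state :: "'s \<Rightarrow> observation \<Rightarrow> 's"
  action :: "'s \<Rightarrow> observation \<Rightarrow> port \<times> pebble_action"

text \<open>
  A node may have no free port at all (for example the origin of a narrow wedge). The port chosen is
  then unconstrained, and the agent stays where it is.
\<close>

definition pebble_automaton :: "nat \<Rightarrow> 's automaton \<Rightarrow> bool" where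
  "pebble_automaton k A \<longleftrightarrow> finite (UNIV :: 's set) \<and>
     (\<forall>s F b c. c \<le> k \<longrightarrow>
        (F \<noteq> {} \<longrightarrow> fst (action A s (F, b, c)) \<in> F) \<and>
        (snd (action A s (F, b, c)) = Drop \<longrightarrow> c > 0) \<and>
        (snd (action A s (F, b, c)) = PickUp \<longrightarrow> b))"

record 's configuration =
  state :: 's
  position :: node
  carried :: nat
  pebbles_at :: "node \<Rightarrow> nat"

definition observe :: "node set set \<Rightarrow> 's configuration \<Rightarrow> observation" where
  "observe B c =
     (free_ports B (position c), pebbles_at c (position c) > 0, carried c)"

text \<open>The pebble action takes place at the current node, before the move.\<close>

definition step :: "node set set \<Rightarrow> 's automaton \<Rightarrow> 's configuration \<Rightarrow> 's configuration" where
  "step B A c =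
     (let i = observe B c; u = position c; (d, a) = action A (state c) i
      in \<lparr> state = next_state A (state c) i,
           position = (if d \<in> free_ports B u then neighbour u d else u),
           carried = (case a of Keep \<Rightarrow> carried c | Drop \<Rightarrow> carried c - 1 | PickUp \<Rightarrow> carried c + 1),
           pebbles_at =
             (case a of
                Keep \<Rightarrow> pebbles_at c
              | Drop \<Rightarrow> (pebbles_at c)(u := pebbles_at c u + 1)
              | PickUp \<Rightarrow> (pebbles_at c)(u := pebbles_at c u - 1)) \<rparr>)"

definition start :: "nat \<Rightarrow> 's automaton \<Rightarrow> node \<Rightarrow> 's configuration" where
  "start k A u = \<lparr> state = init A, position = u, carried = k, pebbles_at = (\<lambda>_. 0) \<rparr>"

definition explores :: "nat \<Rightarrow> 's automaton \<Rightarrow> node set set \<Rightarrow> node set \<Rightarrow> bool" where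
  "explores k A B V \<longleftrightarrow>
     (\<forall>u\<in>V. \<forall>w\<in>V. \<exists>n. position ((step B A ^^ n) (start k A u)) = w)"

end

theory Submission
  imports Defs
begin

text \<open>
  A blocked port can only be seen within distance 1 of the first half-line. As long as the agent sees
  no blocked port, it runs through its states like a machine without input, so its position is a
  uniform linear motion up to a bounded error. The half-line being convex, the agent stays within a
  bounded distance of it between two consecutive contacts. Hence every trajectory is contained in three
  tubes around lines: the motion before the first contact, a neighbourhood of the half-line, and the
  motion after the last contact. A ray inside the wedge parallel to none of them leaves all three.
\<close>

section \<open>Drift of a finite machine without input\<close>

text \<open>The parameter \<open>r\<close> takes negative values too, so this is a neighbourhood of
  a full line. For \<open>d = 0\<close> it is a ball, which covers a machine that merely
  circles.\<close>

definition tube :: "'a::real_normed_vector \<Rightarrow> 'a \<Rightarrow> real \<Rightarrow> 'a set" where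
  "tube c d M = {c + r *\<^sub>R d + e | r e. norm e \<le> M}"

lemma tubeI: "norm (z - c - r *\<^sub>R d) \<le> M \<Longrightarrow> z \<in> tube c d M"
  unfolding tube_def by (auto intro!: exI[of _ r] exI[of _ "z - c - r *\<^sub>R d"])

text \<open>The orbit of \<open>s\<close> in a finite set is eventually periodic. With
  \<open>d\<close> the mean of \<open>v\<close> over one period, the deviation from uniform motion
  is eventually periodic as well, hence takes finitely many values.\<close>

lemma drift_bounded:
  fixes g :: "'s \<Rightarrow> 's" and v :: "'s \<Rightarrow> 'a::real_normed_vector"
  assumes "finite (UNIV :: 's set)"
  shows "\<exists>d M. \<forall>k. norm ((\<Sum>i<k. v ((g ^^ i) s)) - real k *\<^sub>R d) \<le> M"
proof -
  define D where "D k = (\<Sum>i<k. v ((g ^^ i) s))" for k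
  have "\<not> inj (\<lambda>k. (g ^^ k) s)"
    using assms finite_subset[OF subset_UNIV] finite_imageD infinite_UNIV_nat by metis
  then obtain m n where "m \<noteq> n" "(g ^^ m) s = (g ^^ n) s"
    by (auto simp: inj_on_def)
  then obtain m P where P: "P > 0" and eq: "(g ^^ (m + P)) s = (g ^^ m) s"
    by (metis add_diff_inverse_nat less_imp_le_nat linorder_neqE_nat not_less zero_less_diff)
  have per: "(g ^^ (k + P)) s = (g ^^ k) s" if "k \<ge> m" for k
    using that
  proof (induction k rule: dec_induct)
    case base
    show ?case by (rule eq)
  next
    case (step k)
    then show ?case by simp
  qed
  define d where "d = (D (m + P) - D m) /\<^sub>R real P"
  have diff: "D (k + P) - D k = real P *\<^sub>R d" if "k \<ge> m" for k
    using that
  proof (induction k rule: dec_induct)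
    case base
    show ?case using P by (simp add: d_def)
  next
    case (step k)
    have "D (Suc k + P) - D (Suc k) = D (k + P) - D k + (v ((g ^^ (k + P)) s) - v ((g ^^ k) s))"
      by (simp add: D_def)
    then show ?case using step per by simp
  qed
  \<comment> \<open>By \<open>diff\<close>, this deviation has period \<open>P\<close> from
    \<open>m\<close> on, so all its values occur before \<open>m + P\<close>.\<close>
  define E where "E k = D k - real k *\<^sub>R d" for k
  have E: "E k \<in> E ` {..<m + P}" for k
  proof (induction k rule: less_induct)
    case (less k)
    show ?case
    proof (cases "k < m + P")
      case False
      then have "k - P \<ge> m" "k - P + P = k" by auto
      then have "E k = E (k - P)"
        using diff[of "k - P"] by (simp add: E_def scaleR_diff_left algebra_simps of_nat_diff)
      then show ?thesis
        using less[of "k - P"] P False by auto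
    qed auto
  qed
  have "norm (E k) \<le> Max (norm ` E ` {..<m + P})" for k
    using E[of k] by (intro Max_ge) auto
  then show ?thesis
    unfolding E_def D_def by blast
qed

text \<open>The agent can leave the wall in any state, any number of times. One bound for all these
  departures exists because there are finitely many states; the velocity \<open>d\<close> still
  depends on the state.\<close>

lemma drift_uniformly_bounded:
  fixes g :: "'s \<Rightarrow> 's" and v :: "'s \<Rightarrow> 'a::real_normed_vector"
  assumes "finite (UNIV :: 's set)"
  shows "\<exists>M. \<forall>s. \<exists>d. \<forall>k. norm ((\<Sum>i<k. v ((g ^^ i) s)) - real k *\<^sub>R d) \<le> M"
proof -
  obtain d M where M: "norm ((\<Sum>i<k. v ((g ^^ i) s)) - real k *\<^sub>R d s) \<le> M s" for s k
    using drift_bounded[OF assms, of v g] by metis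
  have "M s \<le> Max (range M)" for s
    using assms by (intro Max_ge) auto
  then show ?thesis
    using M order_trans by blast
qed

section \<open>Confinement of a trajectory to three tubes\<close>

text \<open>Between consecutive contacts the motion is nearly uniform, so it follows a chord joining
  two points of \<open>H\<close>. Convexity keeps that chord in \<open>H\<close>, and the error does
  not grow with the length of the excursion.\<close>

lemma trajectory_in_three_tubes:
  fixes x :: "nat \<Rightarrow> 'a::real_normed_vector" and contact :: "nat \<Rightarrow> bool"
  assumes drift: "\<And>t. \<exists>d. \<forall>k. (\<forall>i<k. \<not> contact (t + i)) \<longrightarrow>
                        norm (x (t + k) - x t - real k *\<^sub>R d) \<le> M"
    and speed: "\<And>t. norm (x (Suc t) - x t) \<le> 1"
    and contact: "\<And>t. contact t \<Longrightarrow> \<exists>h\<in>H. norm (x t - h) \<le> 1"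
    and "convex H" and H: "H \<subseteq> tube a b 0"
  shows "\<exists>c d c' d' K. range x \<subseteq> tube c d K \<union> tube a b K \<union> tube c' d' K"
proof -
  have M: "M \<ge> 0"
    using drift[of 0] by (auto dest: spec[of _ 0])
  \<comment> \<open>One \<open>M\<close> separates \<open>x t\<close> from the uniform motion; the
    remaining \<open>M + 2\<close> bounds the distance from that motion to the chord.\<close>
  define K where "K = 2 * M + 2"
  have between: "\<exists>h\<in>H. norm (x t - h) \<le> K" if "t0 < t" "t \<le> t1" "contact t0" "contact t1" for t t0 t1
  proof -
    \<comment> \<open>\<open>l\<close> is the last contact before \<open>t\<close>, and
      \<open>n\<close> below is the first one at \<open>t\<close> or later. The uniform motion is
      started at \<open>Suc l\<close>, since the move made at \<open>l\<close> depends on the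
      blocked ports seen there.\<close>
    define l where "l = Max {i. i < t \<and> contact i}"
    have "l \<in> {i. i < t \<and> contact i}"
      unfolding l_def using that by (intro Max_in) auto
    then have l: "l < t" "contact l" by auto
    have "i \<le> l" if "i < t" "contact i" for i
      unfolding l_def using that by (intro Max_ge) auto
    then have l_max: "\<not> contact i" if "l < i" "i < t" for i
      using that by force
    define n where "n = (LEAST i. t \<le> i \<and> contact i)"
    have n: "t \<le> n" "contact n"
      unfolding n_def using LeastI[of "\<lambda>i. t \<le> i \<and> contact i" t1] that by auto
    have n_min: "\<not> contact i" if "t \<le> i" "i < n" for i
      using that not_less_Least[of i "\<lambda>i. t \<le> i \<and> contact i"] by (auto simp: n_def)
    obtain d where d: "\<And>k. (\<forall>i<k. \<not> contact (Suc l + i)) \<Longrightarrow>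
        norm (x (Suc l + k) - x (Suc l) - real k *\<^sub>R d) \<le> M"
      using drift by blast
    have no_contact: "\<not> contact (Suc l + i)" if "Suc l + i < n" for i
      using l_max[of "Suc l + i"] n_min[of "Suc l + i"] that by linarith
    obtain k where k: "t = Suc l + k"
      using l(1) less_iff_Suc_add by auto
    obtain j where j: "n = Suc l + k + j"
      using n(1) k le_iff_add by blast
    have dk: "norm (x t - x (Suc l) - real k *\<^sub>R d) \<le> M"
      unfolding k using no_contact j by (intro d) auto
    have "norm (x (Suc l + (k + j)) - x (Suc l) - real (k + j) *\<^sub>R d) \<le> M"
      using no_contact j by (intro d) auto
    then have dn: "norm (x n - x (Suc l) - real (k + j) *\<^sub>R d) \<le> M"
      by (simp add: j add.assoc)
    obtain h where h: "h \<in> H" "norm (x l - h) \<le> 1" using contact l by blast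
    obtain h' where h': "h' \<in> H" "norm (x n - h') \<le> 1" using contact n by blast
    have hl: "norm (x (Suc l) - h) \<le> 2"
      using norm_triangle_ineq[of "x (Suc l) - x l" "x l - h"] speed[of l] h by simp
    have hn: "norm (x (Suc l) + real (k + j) *\<^sub>R d - h') \<le> M + 1"
      using norm_triangle_ineq4[of "x n - h'" "x n - x (Suc l) - real (k + j) *\<^sub>R d"] dn h'
      by (simp add: algebra_simps)
    \<comment> \<open>The fraction of the excursion elapsed at time \<open>t\<close>. If
      \<open>k + j = 0\<close>, then \<open>k = 0\<close> and the value 0 still satisfies the third
      fact below.\<close>
    define s where "s = (if k + j = 0 then 0 else real k / real (k + j))"
    have s: "0 \<le> s" "s \<le> 1" "real k = s * real (k + j)"
      by (auto simp: s_def divide_simps)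
    \<comment> \<open>The uniform motion at time \<open>k\<close> is the convex combination of its
      two end positions with weights \<open>1 - s\<close> and \<open>s\<close>, the same weights as
      for the chord point.\<close>
    have "norm ((x (Suc l) + real k *\<^sub>R d) - ((1 - s) *\<^sub>R h + s *\<^sub>R h'))
        = norm ((1 - s) *\<^sub>R (x (Suc l) - h) + s *\<^sub>R (x (Suc l) + real (k + j) *\<^sub>R d - h'))"
      unfolding s(3) by (simp add: algebra_simps)
    also have "\<dots> \<le> (1 - s) * norm (x (Suc l) - h) + s * norm (x (Suc l) + real (k + j) *\<^sub>R d - h')"
      using s by (intro norm_triangle_le) simp
    also have "\<dots> \<le> (1 - s) * (M + 2) + s * (M + 2)"
      using s hl hn M by (intro add_mono mult_left_mono) auto
    also have "\<dots> = M + 2" by (simp add: algebra_simps)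
    finally have "norm ((x t - x (Suc l) - real k *\<^sub>R d) +
        ((x (Suc l) + real k *\<^sub>R d) - ((1 - s) *\<^sub>R h + s *\<^sub>R h'))) \<le> M + (M + 2)"
      using dk by (intro norm_triangle_mono)
    then have "norm (x t - ((1 - s) *\<^sub>R h + s *\<^sub>R h')) \<le> K"
      by (simp add: K_def algebra_simps)
    moreover have "(1 - s) *\<^sub>R h + s *\<^sub>R h' \<in> H"
      using \<open>convex H\<close> h h' s by (auto simp: convex_alt)
    ultimately show ?thesis by blast
  qed
  have near: "z \<in> tube a b K" if "h \<in> H" "norm (z - h) \<le> K" for z h
  proof -
    obtain r where "h = a + r *\<^sub>R b"
      using H \<open>h \<in> H\<close> by (auto simp: tube_def)
    then show ?thesis using that by (intro tubeI[of _ _ r]) (simp add: diff_diff_eq)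
  qed
  \<comment> \<open>If contacts never cease, \<open>T\<close> is an unspecified number; the third
    tube is then still defined, but the case that relies on it does not arise.\<close>
  define T where "T = (LEAST T. \<forall>i\<ge>T. \<not> contact i)"
  obtain d where d: "\<And>k. (\<forall>i<k. \<not> contact (0 + i)) \<Longrightarrow> norm (x (0 + k) - x 0 - real k *\<^sub>R d) \<le> M"
    using drift by blast
  obtain d' where d': "\<And>k. (\<forall>i<k. \<not> contact (T + i)) \<Longrightarrow> norm (x (T + k) - x T - real k *\<^sub>R d') \<le> M"
    using drift by blast
  have "x t \<in> tube (x 0) d K \<union> tube a b K \<union> tube (x T) d' K" for t
  proof -
    consider "\<forall>i<t. \<not> contact i" | t0 t1 where "t0 < t" "t \<le> t1" "contact t0" "contact t1"
      | "\<forall>i\<ge>t. \<not> contact i" by auto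
    then show ?thesis
    proof cases
      case 1
      then have "norm (x t - x 0 - real t *\<^sub>R d) \<le> K"
        using d[of t] M by (simp add: K_def)
      then show ?thesis using tubeI by blast
    next
      case 2
      then show ?thesis using between near by blast
    next
      case 3
      then have T: "T \<le> t" "\<forall>i\<ge>T. \<not> contact i"
        unfolding T_def by (rule Least_le, rule LeastI)
      then have "norm (x t - x T - real (t - T) *\<^sub>R d') \<le> K"
        using d'[of "t - T"] M by (simp add: K_def)
      then show ?thesis using tubeI by blast
    qed
  qed
  then show ?thesis by blast
qed

section \<open>Grid nodes of the wedge outside finitely many strips\<close>

lemma tube_in_strip:
  fixes c d :: complex
  shows "\<exists>n K. n \<noteq> 0 \<and> (\<forall>z\<in>tube c d M. \<bar>n \<bullet> z\<bar> \<le> K)"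
proof -
  \<comment> \<open>Multiplication by \<open>\<i>\<close> turns \<open>d\<close> by a right angle.
    For \<open>d = 0\<close> any nonzero normal will do.\<close>
  define n where "n = (if d = 0 then 1 else \<i> * d)"
  have n: "n \<noteq> 0" "n \<bullet> d = 0"
    by (auto simp: n_def inner_complex_def)
  have "\<bar>n \<bullet> z\<bar> \<le> \<bar>n \<bullet> c\<bar> + norm n * M" if z: "z \<in> tube c d M" for z
  proof -
    obtain r e where e: "z = c + r *\<^sub>R d + e" "norm e \<le> M"
      using z by (auto simp: tube_def)
    then have "\<bar>n \<bullet> z\<bar> \<le> \<bar>n \<bullet> c\<bar> + \<bar>n \<bullet> e\<bar>"
      using n by (simp add: inner_add_right)
    also have "\<bar>n \<bullet> e\<bar> \<le> norm n * norm e"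
      by (rule Cauchy_Schwarz_ineq2)
    also have "\<dots> \<le> norm n * M"
      using e by (simp add: mult_left_mono)
    finally show ?thesis by simp
  qed
  then show ?thesis using n by blast
qed

lemma cis_orthogonal_unique:
  assumes "n \<noteq> 0" "n \<bullet> cis \<alpha> = 0" "n \<bullet> cis \<beta> = 0" "\<bar>\<alpha> - \<beta>\<bar> < pi"
  shows "\<alpha> = \<beta>"
proof -
  have eqs: "Re n * cos \<alpha> + Im n * sin \<alpha> = 0" "Re n * cos \<beta> + Im n * sin \<beta> = 0"
    using assms by (auto simp: inner_complex_def)
  \<comment> \<open>Up to sign, \<open>sin (\<alpha> - \<beta>)\<close> is the determinant of the
    linear system \<open>eqs\<close> in \<open>Re n\<close> and \<open>Im n\<close>.\<close>
  have "sin (\<alpha> - \<beta>) * Re n = 0" "sin (\<alpha> - \<beta>) * Im n = 0"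
    unfolding sin_diff using eqs by algebra+
  then have "sin (\<alpha> - \<beta>) = 0"
    using \<open>n \<noteq> 0\<close> by (auto simp: complex_eq_iff)
  then show ?thesis
    using assms(4) sin_gt_zero[of "\<alpha> - \<beta>"] sin_gt_zero[of "\<beta> - \<alpha>"]
    by (cases \<alpha> \<beta> rule: linorder_cases) (auto simp: sin_diff algebra_simps)
qed

text \<open>Each normal excludes at most one angle from an open interval of length at most
  \<open>pi\<close>, so finitely many normals cannot exhaust it.\<close>

lemma exists_direction_avoiding:
  assumes "\<theta>2 < \<theta>1" "finite N" "0 \<notin> N"
  shows "\<exists>\<theta>. \<theta>2 < \<theta> \<and> \<theta> < \<theta>1 \<and> (\<forall>n\<in>N. n \<bullet> cis \<theta> \<noteq> 0)"
proof -
  \<comment> \<open>The cut at \<open>\<theta>2 + pi\<close> keeps opposite directions, which are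
    orthogonal to the same \<open>n\<close>, from both lying in the interval.\<close>
  define b where "b = min \<theta>1 (\<theta>2 + pi)"
  have "\<theta>2 < b" using assms by (simp add: b_def)
  define Z where "Z n = {\<theta> \<in> {\<theta>2<..<b}. n \<bullet> cis \<theta> = 0}" for n
  have "finite (Z n)" if "n \<in> N" for n
  proof (cases "Z n = {}")
    case False
    then obtain \<alpha> where \<alpha>: "\<alpha> \<in> Z n" by blast
    have "n \<noteq> 0" using that assms by auto
    then have "\<beta> = \<alpha>" if "\<beta> \<in> Z n" for \<beta>
      using that \<alpha> by (auto simp: b_def Z_def intro!: cis_orthogonal_unique[of n \<beta> \<alpha>])
    then have "Z n \<subseteq> {\<alpha>}" by blast
    then show ?thesis by (rule finite_subset) simp
  qed simp
  then have "finite (\<Union>n\<in>N. Z n)"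
    using assms by blast
  then have "infinite ({\<theta>2<..<b} - (\<Union>n\<in>N. Z n))"
    using infinite_Ioo[OF \<open>\<theta>2 < b\<close>] by (rule Diff_infinite_finite)
  then have "{\<theta>2<..<b} - (\<Union>n\<in>N. Z n) \<noteq> {}"
    by (rule infinite_imp_nonempty)
  then obtain \<theta> where "\<theta> \<in> {\<theta>2<..<b}" "\<theta> \<notin> (\<Union>n\<in>N. Z n)"
    by blast
  then have "\<theta>2 < \<theta> \<and> \<theta> < \<theta>1 \<and> (\<forall>n\<in>N. n \<bullet> cis \<theta> \<noteq> 0)"
    by (simp add: b_def Z_def)
  then show ?thesis by (rule exI)
qed

definition round_node :: "complex \<Rightarrow> node" where
  "round_node z = (\<lfloor>Re z\<rfloor>, \<lfloor>Im z\<rfloor>)"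

lemma norm_round_node: "norm (point (round_node z) - z) \<le> 2"
proof -
  have "norm (point (round_node z) - z) \<le> \<bar>of_int \<lfloor>Re z\<rfloor> - Re z\<bar> + \<bar>of_int \<lfloor>Im z\<rfloor> - Im z\<bar>"
    using cmod_le[of "point (round_node z) - z"] by (simp add: point_def round_node_def)
  also have "\<dots> \<le> 2"
    by linarith
  finally show ?thesis .
qed

text \<open>Rounding displaces a point by a bounded amount, so far out it changes the direction seen
  from \<open>p\<close> by less than the margin between \<theta> and the sides of the wedge.\<close>

lemma eventually_in_wedge:
  assumes "\<theta>2 < \<theta>" "\<theta> < \<theta>1"
  shows "\<forall>\<^sub>F r in at_top. round_node (p + of_real r * cis \<theta>) \<in> wedge p \<theta>1 \<theta>2"
proof -
  \<comment> \<open>The quotient of the rounded by the exact vector from \<open>p\<close>. It tends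
    to 1, and its argument is the angular error.\<close>
  define w where "w r = (point (round_node (p + of_real r * cis \<theta>)) - p) / (of_real r * cis \<theta>)" for r
  have bound: "norm (w r - 1) \<le> 2 / r" if "r > 0" for r
  proof -
    have "w r - 1 = (point (round_node (p + of_real r * cis \<theta>)) - (p + of_real r * cis \<theta>))
        / (of_real r * cis \<theta>)"
      using that by (simp add: w_def field_simps)
    then show ?thesis
      using norm_round_node[of "p + of_real r * cis \<theta>"] that
      by (simp add: norm_divide norm_mult divide_right_mono)
  qed
  have "((\<lambda>r. w r - 1) \<longlongrightarrow> 0) at_top"
  proof (rule Lim_null_comparison)
    show "\<forall>\<^sub>F r in at_top. norm (w r - 1) \<le> 2 / r"
      using eventually_gt_at_top[of 0] by eventually_elim (rule bound)
    show "((\<lambda>r::real. 2 / r) \<longlongrightarrow> 0) at_top"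
      by (intro tendsto_divide_0[OF tendsto_const] filterlim_at_top_imp_at_infinity filterlim_ident)
  qed
  then have "(w \<longlongrightarrow> 1) at_top"
    by (simp add: Lim_null[of w])
  then have "((\<lambda>r. Arg (w r)) \<longlongrightarrow> Arg 1) at_top"
    by (intro isCont_tendsto_compose[OF continuous_at_Arg]) auto
  then have "((\<lambda>r. Arg (w r)) \<longlongrightarrow> 0) at_top"
    by simp
  then have "\<forall>\<^sub>F r in at_top. \<bar>Arg (w r)\<bar> < min (\<theta>1 - \<theta>) (\<theta> - \<theta>2)"
    using assms by (auto dest: tendstoD[of _ _ _ "min (\<theta>1 - \<theta>) (\<theta> - \<theta>2)"] simp: dist_real_def)
  then show ?thesis
    using eventually_gt_at_top[of 0]
  proof eventually_elim
    case (elim r)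
    have "point (round_node (p + of_real r * cis \<theta>)) = p + w r * (of_real r * cis \<theta>)"
      using elim by (simp add: w_def)
    also have "w r = of_real (norm (w r)) * cis (Arg (w r))"
      by (metis rcis_cmod_Arg rcis_def)
    finally have "point (round_node (p + of_real r * cis \<theta>))
        = p + of_real (norm (w r) * r) * cis (\<theta> + Arg (w r))"
      by (simp add: cis_mult[symmetric] mult_ac)
    moreover have "\<theta> + Arg (w r) \<in> {\<theta>2..\<theta>1}" "norm (w r) * r \<ge> 0"
      using elim by auto
    ultimately show ?case
      unfolding wedge_def clockwise_region_def half_line_def by blast
  qed
qed

text \<open>Along a ray in the wedge whose direction is orthogonal to no \<open>n\<close> in
  \<open>N\<close>, every \<open>\<bar>n \<bullet> z\<bar>\<close> grows linearly and rounding
  alters it only boundedly.\<close>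

lemma wedge_not_in_strips:
  assumes "\<theta>2 < \<theta>1" "finite N" "0 \<notin> N"
  shows "\<exists>u\<in>wedge p \<theta>1 \<theta>2. \<forall>n\<in>N. \<bar>n \<bullet> point u\<bar> > K n"
proof -
  obtain \<theta> where \<theta>: "\<theta>2 < \<theta>" "\<theta> < \<theta>1" and nz: "\<And>n. n \<in> N \<Longrightarrow> n \<bullet> cis \<theta> \<noteq> 0"
    using exists_direction_avoiding[OF assms] by blast
  let ?u = "\<lambda>r. round_node (p + of_real r * cis \<theta>)"
  have "\<forall>\<^sub>F r in at_top. \<bar>n \<bullet> point (?u r)\<bar> > K n" if "n \<in> N" for n
    using eventually_gt_at_top[of "(K n + \<bar>n \<bullet> p\<bar> + norm n * 2) / \<bar>n \<bullet> cis \<theta>\<bar>"]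
  proof eventually_elim
    case (elim r)
    then have "K n + \<bar>n \<bullet> p\<bar> + norm n * 2 < r * \<bar>n \<bullet> cis \<theta>\<bar>"
      using nz[OF that] by (simp add: field_simps)
    also have "\<dots> \<le> \<bar>n \<bullet> (of_real r * cis \<theta>)\<bar>"
      using mult_right_mono[OF abs_ge_self[of r], of "\<bar>n \<bullet> cis \<theta>\<bar>"]
      by (simp add: scaleR_conv_of_real[symmetric] abs_mult del: cis.simps)
    finally have *: "K n + \<bar>n \<bullet> p\<bar> + norm n * 2 < \<bar>n \<bullet> (of_real r * cis \<theta>)\<bar>" .
    have "\<bar>n \<bullet> (point (?u r) - (p + of_real r * cis \<theta>))\<bar> \<le> norm n * 2"
      using Cauchy_Schwarz_ineq2 norm_round_node by (metis mult_left_mono norm_ge_zero order_trans)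
    then show ?case
      using * by (simp only: inner_diff_right inner_add_right)
  qed
  then have "\<forall>\<^sub>F r in at_top. \<forall>n\<in>N. \<bar>n \<bullet> point (?u r)\<bar> > K n"
    using \<open>finite N\<close> by (simp add: eventually_ball_finite)
  then have "\<forall>\<^sub>F r in at_top. ?u r \<in> wedge p \<theta>1 \<theta>2 \<and> (\<forall>n\<in>N. \<bar>n \<bullet> point (?u r)\<bar> > K n)"
    using eventually_in_wedge[OF \<theta>] by eventually_elim blast
  then show ?thesis
    using eventually_happens'[OF trivial_limit_at_top_linorder] by blast
qed

section \<open>The first half-line and the blocked ports\<close>

lemma convex_half_line: "convex (half_line p \<theta>)"
proof (rule convexI)
  fix x y and s t :: real
  assume "x \<in> half_line p \<theta>" "y \<in> half_line p \<theta>" and st: "0 \<le> s" "0 \<le> t" "s + t = 1"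
  then obtain a b where ab: "a \<ge> 0" "x = p + of_real a * cis \<theta>" "b \<ge> 0" "y = p + of_real b * cis \<theta>"
    by (auto simp: half_line_def)
  have "s *\<^sub>R x + t *\<^sub>R y = (s + t) *\<^sub>R p + of_real (s * a + t * b) * cis \<theta>"
    unfolding ab by (simp add: scaleR_conv_of_real algebra_simps)
  then show "s *\<^sub>R x + t *\<^sub>R y \<in> half_line p \<theta>"
    using st ab unfolding half_line_def by (intro CollectI exI[of _ "s * a + t * b"]) auto
qed

lemma half_line_subset_tube: "half_line p \<theta> \<subseteq> tube p (cis \<theta>) 0"
  by (auto simp: half_line_def tube_def scaleR_conv_of_real)

lemma point_neighbour: "point (neighbour u d) = point u + point (neighbour (0, 0) d)"
  by (cases u; cases d) (auto simp: point_def complex_eq_iff)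

lemma norm_point_neighbour: "norm (point (neighbour u d) - point u) = 1"
  by (cases u; cases d) (auto simp: point_def cmod_def)

text \<open>Every edge that does not cross the first half-line is free. A blocked edge therefore
  meets that half-line, even where both half-lines meet the edge, and it has length 1.\<close>

lemma blocked_near_half_line:
  assumes "semi_walled p \<theta>1 \<theta>2 B" "free_ports B u \<noteq> UNIV"
  shows "\<exists>h\<in>half_line p \<theta>1. norm (point u - h) \<le> 1"
proof -
  obtain d where "{u, neighbour u d} \<in> B"
    using assms(2) by (auto simp: free_ports_def)
  then have "{u, neighbour u d} \<in> crossing_edges (wedge p \<theta>1 \<theta>2) (half_line p \<theta>1)"
    using assms(1) by (auto simp: semi_walled_def is_free_def Let_def)
  then obtain h where h: "h \<in> half_line p \<theta>1" "h \<in> closed_segment (point u) (point (neighbour u d))"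
    unfolding crossing_edges_def by (auto simp: doubleton_eq_iff closed_segment_commute)
  then have "norm (h - point u) \<le> norm (point u - point (neighbour u d))"
    using segment_bound(1)[of h "point u" "point (neighbour u d)"] by (simp add: norm_minus_commute)
  then show ?thesis
    using h norm_point_neighbour[of u d] by (metis norm_minus_commute)
qed

section \<open>Runs without pebbles\<close>

text \<open>An invariant of runs with \<open>p = 0\<close>; under it the free ports are the only
  varying part of an observation.\<close>

definition pebbleless :: "'s configuration \<Rightarrow> bool" where
  "pebbleless c \<longleftrightarrow> carried c = 0 \<and> pebbles_at c = (\<lambda>_. 0)"

lemma pebbleless_step:
  assumes "pebble_automaton 0 A" "pebbleless c"
  shows "pebbleless (step B A c)"
proof -
  obtain d a where da: "action A (state c) (free_ports B (position c), False, 0) = (d, a)"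
    by (rule prod.exhaust)
  have "a \<noteq> Drop \<and> a \<noteq> PickUp"
    using assms(1)[unfolded pebble_automaton_def, THEN conjunct2, THEN spec[of _ "state c"],
        THEN spec[of _ "free_ports B (position c)"], THEN spec[of _ False], THEN spec[of _ 0]]
    by (simp add: da)
  then have "a = Keep"
    by (cases a) auto
  then show ?thesis
    using assms(2) da by (simp add: pebbleless_def step_def observe_def Let_def)
qed

lemma norm_step: "norm (point (position (step B A c)) - point (position c)) \<le> 1"
  by (simp add: step_def Let_def split: prod.split) (simp add: norm_point_neighbour)

lemma step_unblocked:
  assumes "pebbleless c" "free_ports B (position c) = UNIV"
  shows "state (step B A c) = next_state A (state c) (UNIV, False, 0)"
    and "position (step B A c) = neighbour (position c) (fst (action A (state c) (UNIV, False, 0)))"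
  using assms by (auto simp: pebbleless_def step_def observe_def Let_def split: prod.split)

text \<open>With all four ports free the observation is constantly \<open>(UNIV, False, 0)\<close>,
  so the states iterate \<open>g\<close> and the moves are a function of the state. This brings the
  run into the form treated by \<open>drift_bounded\<close>.\<close>

lemma run_unblocked:
  fixes A :: "'s automaton"
  defines "g \<equiv> \<lambda>s. next_state A s (UNIV, False, 0)"
  assumes "\<And>i. i < k \<Longrightarrow> pebbleless (x i) \<and> free_ports B (position (x i)) = UNIV"
    and "\<And>i. x (Suc i) = step B A (x i)"
  shows "state (x k) = (g ^^ k) (state (x 0)) \<and>
         point (position (x k)) = point (position (x 0)) +
           (\<Sum>i<k. point (neighbour (0, 0) (fst (action A ((g ^^ i) (state (x 0))) (UNIV, False, 0)))))"
  using assms(2)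
proof (induction k)
  case (Suc k)
  then have "pebbleless (x k)" "free_ports B (position (x k)) = UNIV"
    by auto
  note step = step_unblocked[OF this, of A]
  have "state (x (Suc k)) = g (state (x k))"
    by (simp add: assms(3) step g_def)
  moreover have "point (position (x (Suc k))) = point (position (x k)) +
      point (neighbour (0, 0) (fst (action A (state (x k)) (UNIV, False, 0))))"
    unfolding assms(3) step by (rule point_neighbour)
  ultimately show ?case
    using Suc by (simp add: add.assoc)
qed simp

theorem theorem3:
  fixes p :: complex and \<theta>1 \<theta>2 :: real and B :: "node set set" and A :: "'s automaton"
  assumes "\<theta>1 - 2 * pi \<le> \<theta>2" and "\<theta>2 < \<theta>1"
    and "semi_walled p \<theta>1 \<theta>2 B"
    and "pebble_automaton 0 A"
  shows "\<not> explores 0 A B (wedge p \<theta>1 \<theta>2)"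
proof
  assume expl: "explores 0 A B (wedge p \<theta>1 \<theta>2)"
  \<comment> \<open>With no strips to avoid, the lemma just says that the wedge contains a
    node.\<close>
  obtain u where u: "u \<in> wedge p \<theta>1 \<theta>2"
    using wedge_not_in_strips[OF assms(2), of "{}" p] by auto
  define x where "x t = (step B A ^^ t) (start 0 A u)" for t
  have x_Suc: "x (Suc t) = step B A (x t)" for t
    by (simp add: x_def)
  have pebbleless: "pebbleless (x t)" for t
  proof (induction t)
    case 0
    show ?case by (simp add: x_def pebbleless_def start_def)
  qed (simp add: x_Suc pebbleless_step assms)
  define contact where "contact t \<longleftrightarrow> free_ports B (position (x t)) \<noteq> UNIV" for t
  define g where "g s = next_state A s (UNIV, False, 0)" for s
  define v where "v s = point (neighbour (0, 0) (fst (action A s (UNIV, False, 0))))" for s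
  have "finite (UNIV :: 's set)"
    using assms(4) by (simp add: pebble_automaton_def)
  then have "\<exists>M. \<forall>s. \<exists>d. \<forall>k. norm ((\<Sum>i<k. v ((g ^^ i) s)) - real k *\<^sub>R d) \<le> M"
    by (rule drift_uniformly_bounded)
  then obtain M where M: "\<forall>s. \<exists>d. \<forall>k. norm ((\<Sum>i<k. v ((g ^^ i) s)) - real k *\<^sub>R d) \<le> M"
    by (elim exE)
  have drift: "\<exists>d. \<forall>k. (\<forall>i<k. \<not> contact (t + i)) \<longrightarrow>
      norm (point (position (x (t + k))) - point (position (x t)) - real k *\<^sub>R d) \<le> M" for t
  proof -
    obtain d where d: "\<And>k. norm ((\<Sum>i<k. v ((g ^^ i) (state (x t)))) - real k *\<^sub>R d) \<le> M"
      using M by blast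
    have "norm (point (position (x (t + k))) - point (position (x t)) - real k *\<^sub>R d) \<le> M"
      if "\<forall>i<k. \<not> contact (t + i)" for k
    proof -
      have "point (position (x (t + k))) = point (position (x t)) + (\<Sum>i<k. v ((g ^^ i) (state (x t))))"
        using run_unblocked[of k "\<lambda>i. x (t + i)" B A] that pebbleless
        by (simp add: contact_def x_Suc g_def[abs_def] v_def)
      then show ?thesis
        using d[of k] by simp
    qed
    then show ?thesis by blast
  qed
  have "\<exists>c d c' d' K. range (\<lambda>t. point (position (x t))) \<subseteq>
      tube c d K \<union> tube p (cis \<theta>1) K \<union> tube c' d' K"
  proof (rule trajectory_in_three_tubes[OF drift])
    show "norm (point (position (x (Suc t))) - point (position (x t))) \<le> 1" for t
      unfolding x_Suc by (rule norm_step)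
    show "\<exists>h\<in>half_line p \<theta>1. norm (point (position (x t)) - h) \<le> 1" if "contact t" for t
      using that blocked_near_half_line[OF assms(3)] by (simp add: contact_def)
  qed (rule convex_half_line half_line_subset_tube)+
  then obtain c d c' d' K where tubes: "range (\<lambda>t. point (position (x t))) \<subseteq>
      tube c d K \<union> tube p (cis \<theta>1) K \<union> tube c' d' K"
    by (elim exE)
  obtain n1 K1 where 1: "n1 \<noteq> 0" "\<forall>z\<in>tube c d K. \<bar>n1 \<bullet> z\<bar> \<le> K1"
    using tube_in_strip by blast
  obtain n2 K2 where 2: "n2 \<noteq> 0" "\<forall>z\<in>tube p (cis \<theta>1) K. \<bar>n2 \<bullet> z\<bar> \<le> K2"
    using tube_in_strip by blast
  obtain n3 K3 where 3: "n3 \<noteq> 0" "\<forall>z\<in>tube c' d' K. \<bar>n3 \<bullet> z\<bar> \<le> K3"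
    using tube_in_strip by blast
  \<comment> \<open>The normals may coincide, so one common threshold replaces a bound chosen as a
    function of the normal.\<close>
  obtain w where w: "w \<in> wedge p \<theta>1 \<theta>2" and far: "\<forall>n\<in>{n1, n2, n3}. \<bar>n \<bullet> point w\<bar> > max K1 (max K2 K3)"
    using wedge_not_in_strips[OF assms(2), of "{n1, n2, n3}" p "\<lambda>_. max K1 (max K2 K3)"] 1 2 3
    by auto
  obtain t where "position (x t) = w"
    using expl u w by (auto simp: explores_def x_def)
  then consider "point w \<in> tube c d K" | "point w \<in> tube p (cis \<theta>1) K" | "point w \<in> tube c' d' K"
    using tubes by blast
  then have "\<bar>n1 \<bullet> point w\<bar> \<le> K1 \<or> \<bar>n2 \<bullet> point w\<bar> \<le> K2 \<or> \<bar>n3 \<bullet> point w\<bar> \<le> K3"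
    using 1 2 3 by cases blast+
  then show False
    using far by auto
qed

end
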